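(* Let $G$ be a SIN topological group and let $K$ be a compact normal subgroup of $G$. Suppose that $K$ acts freely on the greatest ambit $S(G)$ and that there is a uniformly continuous cross section $s:G/K\to G$ of the quotient map $G\to G/K$. Then there is a continuous action of $G$ on $S(G/K)\times K$ such that $S(G)\cong S(G/K)\times K$ as $G$-ambits, where the base point of $S(G)$ is $e$ and the base point of $S(G/K)\times K$ is $(K,e)$ (the first coordinate being the neutral element of $G/K$ viewed in $S(G/K)$).
   Context: Topological groups are Hausdorff. For a topological group $G$, a $G$-flow is a continuous left action $G\times X\to X$ on a compact Hausdorff space $X$. A subgroup $K$ acts freely if $kx\neq x$ for all $k\in K\setminus\{e\}$, $x\in X$. A $G$-ambit $(X,x_0)$ is a $G$-flow $X$ with a base point $x_0$ whose orbit $Gx_0$ is dense; an ambit homomorphism is a continuous equivariant map sending base point to base point, and an isomorphism is a bijective homomorphism. The greatest ambit $(S(G),e)$ is the $G$-ambit, unique up to isomorphism, that maps homomorphically onto every $G$-ambit; its phase space is the Samuel compactification of $G$ with respect to the right uniformity, and $G$ is identified with a dense subset of $S(G)$. The right uniformity on $G$ is generated by the open covers $\{Vg:g\in G\}$, $V$ a neighbourhood of $e$; the left uniformity is defined analogously with $gV$. $G$ is SIN if its left and right uniformities coincide. A cross section of $G\to G/K$ is a map $s:G/K\to G$ whose composition with the quotient map is $\mathrm{id}_{G/K}$; it is uniformly continuous if it is so with respect to the right uniformities on $G/K$ and $G$. *)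

theory Defs
  imports "HOL-Analysis.Analysis" "HOL-Algebra.Group_Action"
begin

locale topological_group = group G for G (structure) +
  fixes T :: "'a topology"
  assumes topspace_eq: "topspace T = carrier G"
    and continuous_mult: "continuous_map (prod_topology T T) T (\<lambda>(x, y). x \<otimes> y)"
    and continuous_inv: "continuous_map T T (\<lambda>x. inv x)"
    and Hausdorff: "Hausdorff_space T"

text \<open>
  As for the type class \<open>uniform_space\<close>, a uniformity is represented by its filter of
  entourages.  The entourage given by a cover is the union of the squares of its members, so
  \<open>principal (\<Union>g\<in>carrier G. (V #> g) \<times> (V #> g))\<close> below stems from the
  cover \<open>{V g | g \<in> G}\<close>.  The infimum is directed, as \<open>V \<inter> W\<close> refines \<open>V\<close> and \<open>W\<close>.
\<close>

definition right_uniformity :: "('a, 'm) monoid_scheme \<Rightarrow> 'a topology \<Rightarrow> ('a \<times> 'a) filter" where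
  "right_uniformity G T =
     (INF V \<in> {V. openin T V \<and> \<one>\<^bsub>G\<^esub> \<in> V}.
        principal (\<Union>g\<in>carrier G. (V #>\<^bsub>G\<^esub> g) \<times> (V #>\<^bsub>G\<^esub> g)))"

definition left_uniformity :: "('a, 'm) monoid_scheme \<Rightarrow> 'a topology \<Rightarrow> ('a \<times> 'a) filter" where
  "left_uniformity G T =
     (INF V \<in> {V. openin T V \<and> \<one>\<^bsub>G\<^esub> \<in> V}.
        principal (\<Union>g\<in>carrier G. (g <#\<^bsub>G\<^esub> V) \<times> (g <#\<^bsub>G\<^esub> V)))"

locale SIN_group = topological_group +
  assumes SIN: "left_uniformity G T = right_uniformity G T"

definition right_uniformly_continuous ::
  "('a, 'm) monoid_scheme \<Rightarrow> 'a topology \<Rightarrow> ('b, 'n) monoid_scheme \<Rightarrow> 'b topology \<Rightarrow> ('a \<Rightarrow> 'b) \<Rightarrow> bool"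
  where
  "right_uniformly_continuous G T H U f \<longleftrightarrow>
     f \<in> carrier G \<rightarrow> carrier H \<and>
     (LIM (x, y) right_uniformity G T. (f x, f y) :> right_uniformity H U)"

definition quotient_group_topology ::
  "('a, 'm) monoid_scheme \<Rightarrow> 'a topology \<Rightarrow> 'a set \<Rightarrow> 'a set topology" where
  "quotient_group_topology G T K =
     topology (\<lambda>U. U \<subseteq> carrier (G Mod K) \<and> openin T {x \<in> carrier G. K #>\<^bsub>G\<^esub> x \<in> U})"

lemma openin_quotient_group_topology:
  "openin (quotient_group_topology G T K) U \<longleftrightarrow>
     U \<subseteq> carrier (G Mod K) \<and> openin T {x \<in> carrier G. K #>\<^bsub>G\<^esub> x \<in> U}"
proof -
  have "istopology (\<lambda>U. U \<subseteq> carrier (G Mod K) \<and> openin T {x \<in> carrier G. K #>\<^bsub>G\<^esub> x \<in> U})"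
    unfolding istopology_def
  proof (intro conjI allI impI)
    fix S U
    assume "S \<subseteq> carrier (G Mod K) \<and> openin T {x \<in> carrier G. K #>\<^bsub>G\<^esub> x \<in> S}"
      "U \<subseteq> carrier (G Mod K) \<and> openin T {x \<in> carrier G. K #>\<^bsub>G\<^esub> x \<in> U}"
    moreover have "{x \<in> carrier G. K #>\<^bsub>G\<^esub> x \<in> S \<inter> U} =
        {x \<in> carrier G. K #>\<^bsub>G\<^esub> x \<in> S} \<inter> {x \<in> carrier G. K #>\<^bsub>G\<^esub> x \<in> U}" by blast
    ultimately show "S \<inter> U \<subseteq> carrier (G Mod K)"
      "openin T {x \<in> carrier G. K #>\<^bsub>G\<^esub> x \<in> S \<inter> U}" by auto
  next
    fix \<K>
    assume *: "\<forall>U\<in>\<K>. U \<subseteq> carrier (G Mod K) \<and> openin T {x \<in> carrier G. K #>\<^bsub>G\<^esub> x \<in> U}"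
    then show "\<Union>\<K> \<subseteq> carrier (G Mod K)" by blast
    have "{x \<in> carrier G. K #>\<^bsub>G\<^esub> x \<in> \<Union>\<K>} = (\<Union>U\<in>\<K>. {x \<in> carrier G. K #>\<^bsub>G\<^esub> x \<in> U})"
      by blast
    then show "openin T {x \<in> carrier G. K #>\<^bsub>G\<^esub> x \<in> \<Union>\<K>}" using * by auto
  qed
  then show ?thesis unfolding quotient_group_topology_def by simp
qed

definition cross_section :: "('a, 'm) monoid_scheme \<Rightarrow> 'a set \<Rightarrow> ('a set \<Rightarrow> 'a) \<Rightarrow> bool" where
  "cross_section G K s \<longleftrightarrow>
     (\<forall>c\<in>carrier (G Mod K). s c \<in> carrier G \<and> K #>\<^bsub>G\<^esub> s c = c)"

locale flow = topological_group G T + group_action G "topspace X" act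
  for G :: "('a, 'm) monoid_scheme" (structure) and T
    and X :: "'x topology" and act :: "'a \<Rightarrow> 'x \<Rightarrow> 'x" +
  assumes compact: "compact_space X"
    and Hausdorff_phase_space: "Hausdorff_space X"
    and continuous_act: "continuous_map (prod_topology T X) X (\<lambda>(g, x). act g x)"

definition acts_freely ::
  "('a, 'm) monoid_scheme \<Rightarrow> 'a set \<Rightarrow> 'x topology \<Rightarrow> ('a \<Rightarrow> 'x \<Rightarrow> 'x) \<Rightarrow> bool" where
  "acts_freely G K X act \<longleftrightarrow> (\<forall>k\<in>K - {\<one>\<^bsub>G\<^esub>}. \<forall>x\<in>topspace X. act k x \<noteq> x)"

locale ambit = flow +
  fixes x0
  assumes base_point: "x0 \<in> topspace X"
    and dense_orbit: "X closure_of (orbit G act x0) = topspace X"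

definition ambit_hom ::
  "('a, 'm) monoid_scheme \<Rightarrow> 'x topology \<Rightarrow> ('a \<Rightarrow> 'x \<Rightarrow> 'x) \<Rightarrow> 'x \<Rightarrow>
   'y topology \<Rightarrow> ('a \<Rightarrow> 'y \<Rightarrow> 'y) \<Rightarrow> 'y \<Rightarrow> ('x \<Rightarrow> 'y) \<Rightarrow> bool" where
  "ambit_hom G X act x0 Y act' y0 f \<longleftrightarrow>
     continuous_map X Y f \<and> f x0 = y0 \<and>
     (\<forall>g\<in>carrier G. \<forall>x\<in>topspace X. f (act g x) = act' g (f x))"

definition ambit_iso ::
  "('a, 'm) monoid_scheme \<Rightarrow> 'x topology \<Rightarrow> ('a \<Rightarrow> 'x \<Rightarrow> 'x) \<Rightarrow> 'x \<Rightarrow>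
   'y topology \<Rightarrow> ('a \<Rightarrow> 'y \<Rightarrow> 'y) \<Rightarrow> 'y \<Rightarrow> ('x \<Rightarrow> 'y) \<Rightarrow> bool" where
  "ambit_iso G X act x0 Y act' y0 f \<longleftrightarrow>
     ambit_hom G X act x0 Y act' y0 f \<and> bij_betw f (topspace X) (topspace Y)"

text \<open>
  HOL cannot quantify over ambits on all types inside a definition.  It is enough to test
  against ambits on \<open>'a set set\<close>: a point \<open>z\<close> of an ambit with base point \<open>z0\<close> is
  determined by the collection of those \<open>S \<subseteq> G\<close> for which \<open>z\<close> lies in the closure of
  \<open>S z0\<close>.  Lemma \<open>greatest_ambit_maps_onto\<close> below derives the universal property
  for ambits on arbitrary types.
\<close>

definition greatest_ambit ::
  "('a, 'm) monoid_scheme \<Rightarrow> 'a topology \<Rightarrow> 'x topology \<Rightarrow> ('a \<Rightarrow> 'x \<Rightarrow> 'x) \<Rightarrow> 'x \<Rightarrow> bool" where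
  "greatest_ambit G T X act x0 \<longleftrightarrow>
     ambit G T X act x0 \<and>
     (\<forall>(Z :: 'a set set topology) act' z0. ambit G T Z act' z0 \<longrightarrow>
        (\<exists>f. ambit_hom G X act x0 Z act' z0 f \<and> f ` topspace X = topspace Z))"

lemma (in ambit) point_code_inj:
  "inj_on (\<lambda>z. {S. S \<subseteq> carrier G \<and> z \<in> X closure_of ((\<lambda>g. act g x0) ` S)}) (topspace X)"
    (is "inj_on ?j _")
proof (rule inj_onI, rule ccontr)
  fix z w
  assume z: "z \<in> topspace X" and w: "w \<in> topspace X" and eq: "?j z = ?j w" and "z \<noteq> w"
  then obtain U V where UV: "openin X U" "openin X V" "z \<in> U" "w \<in> V" "disjnt U V"
    using Hausdorff_phase_space unfolding Hausdorff_space_def by meson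
  define S where "S = {g \<in> carrier G. act g x0 \<in> U}"
  have "z \<in> X closure_of ((\<lambda>g. act g x0) ` S)"
    unfolding in_closure_of
  proof (intro conjI allI impI)
    fix W assume W: "z \<in> W \<and> openin X W"
    have "openin X (U \<inter> W)" "z \<in> U \<inter> W" using W UV by auto
    moreover have "z \<in> X closure_of (orbit G act x0)" using dense_orbit z by simp
    ultimately obtain y where "y \<in> orbit G act x0" "y \<in> U \<inter> W"
      unfolding in_closure_of by blast
    then show "\<exists>y. y \<in> (\<lambda>g. act g x0) ` S \<and> y \<in> W"
      unfolding orbit_def S_def by blast
  qed (rule z)
  then have "S \<in> ?j z" unfolding S_def by blast
  then have "w \<in> X closure_of ((\<lambda>g. act g x0) ` S)" using eq by blast
  then obtain y where "y \<in> (\<lambda>g. act g x0) ` S" "y \<in> V"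
    using UV unfolding in_closure_of by blast
  then show False using UV unfolding S_def disjnt_def by blast
qed

lemma group_action_transport:
  assumes "group_action G E act" and j: "bij_betw j E E'"
  shows "group_action G E' (\<lambda>g. restrict (\<lambda>w. j (act g (inv_into E j w))) E')"
proof -
  interpret A: group_action G E act by fact
  interpret G: group G using A.group_hom by (simp add: group_hom_def)
  let ?b = "\<lambda>g. restrict (\<lambda>w. j (act g (inv_into E j w))) E'"
  have i: "bij_betw (inv_into E j) E' E" using j by (rule bij_betw_inv_into)
  have b: "bij_betw (act g) E E" if "g \<in> carrier G" for g
    using A.bij_prop0[OF that] by (simp add: Bij_def)
  have Bij: "?b g \<in> Bij E'" if "g \<in> carrier G" for g
  proof -
    have "bij_betw (j \<circ> (act g \<circ> inv_into E j)) E' E'"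
      using i b[OF that] j by (blast intro: bij_betw_trans)
    then have "bij_betw (?b g) E' E'"
      by (subst bij_betw_cong[where g = "j \<circ> (act g \<circ> inv_into E j)"]) auto
    then show ?thesis by (simp add: Bij_def)
  qed
  have "?b \<in> hom G (BijGroup E')"
  proof (rule homI)
    show "?b g \<in> carrier (BijGroup E')" if "g \<in> carrier G" for g
      using Bij[OF that] by (simp add: BijGroup_def)
    fix g h assume gh: "g \<in> carrier G" "h \<in> carrier G"
    have "?b (g \<otimes>\<^bsub>G\<^esub> h) = compose E' (?b g) (?b h)"
    proof
      fix w
      show "?b (g \<otimes>\<^bsub>G\<^esub> h) w = compose E' (?b g) (?b h) w"
      proof (cases "w \<in> E'")
        case True
        then have iw: "inv_into E j w \<in> E" using i by (blast dest: bij_betwE)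
        then have "act h (inv_into E j w) \<in> E" using A.element_image gh by blast
        moreover from this have "j (act h (inv_into E j w)) \<in> E'"
          using j by (blast dest: bij_betwE)
        ultimately show ?thesis
          using True iw gh j by (simp add: compose_def A.composition_rule bij_betw_inv_into_left)
      qed (simp add: compose_def)
    qed
    then show "?b (g \<otimes>\<^bsub>G\<^esub> h) = ?b g \<otimes>\<^bsub>BijGroup E'\<^esub> ?b h"
      using Bij gh by (simp add: BijGroup_def)
  qed
  then show ?thesis
    by (simp add: group_action_def group_hom_def group_hom_axioms_def group_BijGroup
        G.group_axioms)
qed

lemma ambit_transport:
  assumes "ambit G T X act x0" and hom: "homeomorphic_maps X X' j i"
  shows "ambit G T X' (\<lambda>g. restrict (\<lambda>w. j (act g (inv_into (topspace X) j w))) (topspace X')) (j x0)"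
proof -
  interpret A: ambit G T X act x0 by fact
  let ?b = "\<lambda>g. restrict (\<lambda>w. j (act g (inv_into (topspace X) j w))) (topspace X')"
  have hj: "homeomorphic_map X X' j" using hom by (rule homeomorphic_maps_imp_map)
  then have j: "bij_betw j (topspace X) (topspace X')"
    by (simp add: homeomorphic_map_def bij_betw_def homeomorphic_imp_surjective_map)
  have hs: "X homeomorphic_space X'" using hom unfolding homeomorphic_space_def by blast
  have ci: "continuous_map X' X i" and cj: "continuous_map X X' j"
    using hom by (auto simp: homeomorphic_maps_def)
  have inv_eq: "inv_into (topspace X) j w = i w" if "w \<in> topspace X'" for w
    using that hom j by (metis homeomorphic_maps_def bij_betw_inv_into_left continuous_map_image_subset_topspace image_subset_iff)
  have iz: "i (j z) = z" if "z \<in> topspace X" for z using hom that by (auto simp: homeomorphic_maps_def)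
  have "continuous_map (prod_topology T X') X' (j \<circ> ((\<lambda>(g, x). act g x) \<circ> (\<lambda>(g, w). (g, i w))))"
  proof (intro continuous_map_compose[OF _ cj] continuous_map_compose[OF _ A.continuous_act])
    have "continuous_map (prod_topology T X') (prod_topology T X) (\<lambda>p. (fst p, (i \<circ> snd) p))"
      by (intro continuous_map_pairedI continuous_map_fst continuous_map_compose[OF continuous_map_snd ci])
    then show "continuous_map (prod_topology T X') (prod_topology T X) (\<lambda>(g, w). (g, i w))"
      by (simp add: case_prod_unfold)
  qed
  then have cont: "continuous_map (prod_topology T X') X' (\<lambda>(g, w). ?b g w)"
    by (rule continuous_map_eq) (auto simp: inv_eq)
  have x0: "j x0 \<in> topspace X'" using A.base_point j by (blast dest: bij_betwE)
  have orb: "orbit G ?b (j x0) = j ` orbit G act x0"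
    unfolding orbit_def using x0 by (auto simp: inv_eq iz A.base_point)
  have sub: "orbit G act x0 \<subseteq> topspace X"
    unfolding orbit_def using A.element_image A.base_point by blast
  have "X' closure_of (orbit G ?b (j x0)) = j ` (X closure_of (orbit G act x0))"
    unfolding orb using homeomorphic_map_closure_of[OF hj sub] by simp
  also have "\<dots> = topspace X'" using A.dense_orbit j by (simp add: bij_betw_def)
  finally have dense: "X' closure_of (orbit G ?b (j x0)) = topspace X'" .
  have comp: "compact_space X'" using A.compact homeomorphic_compact_space[OF hs] by simp
  have haus: "Hausdorff_space X'"
    using A.Hausdorff_phase_space homeomorphic_Hausdorff_space[OF hs] by simp
  have act: "group_action G (topspace X') ?b"
    using group_action_transport[OF A.group_action_axioms j] .
  show ?thesis
    using A.topological_group_axioms act comp haus cont x0 dense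
    by (intro ambit.intro flow.intro) (simp_all add: flow_axioms_def ambit_axioms_def)
qed

lemma greatest_ambit_maps_onto:
  fixes Z :: "'z topology"
  assumes X: "greatest_ambit G T X act x0" and Z: "ambit G T Z act' z0"
  shows "\<exists>f. ambit_hom G X act x0 Z act' z0 f \<and> f ` topspace X = topspace Z"
proof -
  interpret X: ambit G T X act x0 using X by (simp add: greatest_ambit_def)
  interpret Z: ambit G T Z act' z0 by fact
  obtain j :: "'z \<Rightarrow> 'a set set" where j: "inj_on j (topspace Z)"
    using Z.point_code_inj by blast
  define i where "i = inv_into (topspace Z) j"
  define Z' where "Z' = pullback_topology (j ` topspace Z) i Z"
  have ij: "i (j z) = z" if "z \<in> topspace Z" for z
    unfolding i_def using j that by simp
  have top: "topspace Z' = j ` topspace Z"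
    unfolding Z'_def topspace_pullback_topology using ij by auto
  have ci: "continuous_map Z' Z i"
    unfolding Z'_def using continuous_map_pullback[of Z Z "\<lambda>z. z" "j ` topspace Z" i]
    by (simp add: o_def)
  have cj: "continuous_map Z Z' j"
    unfolding Z'_def
  proof (rule continuous_map_pullback')
    show "continuous_map Z Z (i \<circ> j)"
      by (rule continuous_map_eq[OF continuous_map_id]) (simp add: ij)
  qed auto
  have hom: "homeomorphic_maps Z Z' j i"
    unfolding homeomorphic_maps_def using ci cj top ij by auto
  let ?b = "\<lambda>g. restrict (\<lambda>w. j (act' g (inv_into (topspace Z) j w))) (topspace Z')"
  have "ambit G T Z' ?b (j z0)" by (rule ambit_transport[OF Z hom])
  then obtain f where f: "ambit_hom G X act x0 Z' ?b (j z0) f" "f ` topspace X = topspace Z'"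
    using X unfolding greatest_ambit_def by blast
  have fx: "f x \<in> topspace Z'" if "x \<in> topspace X" for x using f(2) that by blast
  have "ambit_hom G X act x0 Z act' z0 (i \<circ> f)"
    unfolding ambit_hom_def
  proof (intro conjI ballI)
    show "continuous_map X Z (i \<circ> f)"
      using f(1) ci unfolding ambit_hom_def by (blast intro: continuous_map_compose)
    show "(i \<circ> f) x0 = z0" using f(1) ij Z.base_point by (simp add: ambit_hom_def)
    fix g x assume g: "g \<in> carrier G" and x: "x \<in> topspace X"
    have "i (f x) \<in> topspace Z" using fx[OF x] top ij by auto
    then have "act' g (i (f x)) \<in> topspace Z" using Z.element_image g by blast
    then show "(i \<circ> f) (act g x) = act' g ((i \<circ> f) x)"
      using f(1) g x fx[OF x] ij by (simp add: ambit_hom_def i_def)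
  qed
  moreover have "(i \<circ> f) ` topspace X = topspace Z"
    unfolding image_comp[symmetric] f(2) top using ij by force
  ultimately show ?thesis by blast
qed

end

theory Submission
  imports Defs
begin

text \<open>
  The greatest ambit $S(G/K)$ becomes a $G$-ambit when $G$ acts through $G/K$, so there is an
  ambit homomorphism $\pi : S(G) \to S(G/K)$.  As $K$ maps to the neutral element of $G/K$, the map
  $\pi$ is constant on $K$-orbits.  What splits $S(G)$ as a product is a continuous section of
  $\pi$, and this is where the cross section $s$ enters: $c \mapsto s(c)\,x_0$ is a uniformly
  continuous map from $G/K$ to the compact space $S(G)$, so it extends to a continuous
  $\sigma : S(G/K) \to S(G)$, and $\pi \circ \sigma = \mathrm{id}$ because this holds on the dense
  orbit of the base point.

  Consider $\psi(y, k) = k\,s(K)^{-1}\,\sigma(y)$ on $S(G/K) \times K$; the factor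
  $s(K)^{-1} \in K$ corrects for $\sigma$ sending the base point to $s(K)\,x_0$ instead of $x_0$.
  The map $\psi$ is injective: $\pi$ recovers $y$, and then freeness of the action of $K$ recovers
  $k$.  It is surjective: its image is compact and contains $G x_0$, since every $g$ is
  $k\,s(Kg)$ for some $k \in K$.  A continuous bijection from a compact space to a Hausdorff space
  is a homeomorphism, and along it the action of $G$ on $S(G)$ is transported to
  $S(G/K) \times K$.

  The analytic part is the extension of $c \mapsto s(c)\,x_0$, lemma
  \<open>greatest_ambit_extends\<close>.  The greatest ambit is given by its universal property among
  ambits only, so a uniformly continuous map $f$ from a group to a compact space has to be
  realised by an ambit.  This is the orbit closure of $f$ itself in the space of all functions, where
  the group acts by right translation.
\<close>

section \<open>Right uniformly continuous maps into compact spaces\<close>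

text \<open>
  For compact Hausdorff \<open>C\<close>, the open neighbourhoods of the diagonal form a base of its unique
  compatible uniformity, so this is uniform continuity with respect to that uniformity.
\<close>

definition right_uniformly_continuous_into ::
  "('a, 'm) monoid_scheme \<Rightarrow> 'a topology \<Rightarrow> 'c topology \<Rightarrow> ('a \<Rightarrow> 'c) \<Rightarrow> bool" where
  "right_uniformly_continuous_into G T C f \<longleftrightarrow>
     f \<in> carrier G \<rightarrow> topspace C \<and>
     (\<forall>U. openin (prod_topology C C) U \<and> (\<forall>c\<in>topspace C. (c, c) \<in> U) \<longrightarrow>
        (\<forall>\<^sub>F (x, y) in right_uniformity G T. (f x, f y) \<in> U))"

lemma (in topological_group) eventually_right_uniformity:
  "eventually P (right_uniformity G T) \<longleftrightarrow>
     (\<exists>V. openin T V \<and> \<one> \<in> V \<and> (\<forall>g\<in>carrier G. \<forall>x\<in>V #> g. \<forall>y\<in>V #> g. P (x, y)))"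
proof -
  have "eventually P (right_uniformity G T) \<longleftrightarrow>
     (\<exists>V\<in>{V. openin T V \<and> \<one> \<in> V}.
        eventually P (principal (\<Union>g\<in>carrier G. (V #> g) \<times> (V #> g))))"
    unfolding right_uniformity_def
  proof (rule eventually_INF_base)
    show "{V. openin T V \<and> \<one> \<in> V} \<noteq> {}"
      using openin_topspace[of T] topspace_eq by auto
    fix V W assume VW: "V \<in> {V. openin T V \<and> \<one> \<in> V}" "W \<in> {V. openin T V \<and> \<one> \<in> V}"
    have "(V \<inter> W) #> g \<subseteq> V #> g" "(V \<inter> W) #> g \<subseteq> W #> g" for g
      by (auto simp: r_coset_def)
    then show "\<exists>N\<in>{V. openin T V \<and> \<one> \<in> V}.
        principal (\<Union>g\<in>carrier G. (N #> g) \<times> (N #> g))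
        \<le> inf (principal (\<Union>g\<in>carrier G. (V #> g) \<times> (V #> g)))
              (principal (\<Union>g\<in>carrier G. (W #> g) \<times> (W #> g)))"
      using VW by (intro bexI[of _ "V \<inter> W"]) (auto, blast+)
  qed
  also have "\<dots> \<longleftrightarrow>
      (\<exists>V. openin T V \<and> \<one> \<in> V \<and> (\<forall>g\<in>carrier G. \<forall>x\<in>V #> g. \<forall>y\<in>V #> g. P (x, y)))"
    by (auto simp: eventually_principal Bex_def)
  finally show ?thesis .
qed

text \<open>
  Points of a common translate \<open>V #> g\<close> have a quotient in $V V^{-1}$, which lies in any prescribed
  neighbourhood of the neutral element once $V$ is small.
\<close>

lemma (in topological_group) eventually_right_uniformity_divide:
  assumes V: "openin T V" "\<one> \<in> V"
  shows "\<forall>\<^sub>F (x, y) in right_uniformity G T. x \<in> carrier G \<and> y \<in> carrier G \<and> y \<otimes> inv x \<in> V"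
proof -
  have "continuous_map (prod_topology T T) T ((\<lambda>(x, y). x \<otimes> y) \<circ> (\<lambda>p. (snd p, inv (fst p))))"
    by (intro continuous_map_compose[OF _ continuous_mult] continuous_map_pairedI
        continuous_map_snd continuous_map_compose[OF continuous_map_fst continuous_inv, unfolded o_def])
  then have "openin (prod_topology T T) {p \<in> topspace (prod_topology T T). snd p \<otimes> inv (fst p) \<in> V}"
    using V(1) by (auto simp: continuous_map_def)
  moreover have "(\<one>, \<one>) \<in> {p \<in> topspace (prod_topology T T). snd p \<otimes> inv (fst p) \<in> V}"
    using V(2) by (simp add: topspace_eq)
  ultimately obtain A B where AB: "openin T A" "openin T B" "\<one> \<in> A" "\<one> \<in> B"
      "A \<times> B \<subseteq> {p \<in> topspace (prod_topology T T). snd p \<otimes> inv (fst p) \<in> V}"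
    unfolding openin_prod_topology_alt by meson
  show ?thesis
    unfolding eventually_right_uniformity
  proof (intro exI[of _ "A \<inter> B"] conjI ballI)
    fix g x y assume g: "g \<in> carrier G" and "x \<in> (A \<inter> B) #> g" "y \<in> (A \<inter> B) #> g"
    then obtain a b where ab: "a \<in> A" "b \<in> B" "x = a \<otimes> g" "y = b \<otimes> g"
      by (auto simp: r_coset_def)
    then have c: "a \<in> carrier G" "b \<in> carrier G" "b \<otimes> inv a \<in> V"
      using AB by (auto simp: topspace_eq)
    then have "y \<otimes> inv x = b \<otimes> inv a"
      using ab g by (simp add: inv_mult_group m_assoc) (simp flip: m_assoc)
    then show "case (x, y) of (x, y) \<Rightarrow> x \<in> carrier G \<and> y \<in> carrier G \<and> y \<otimes> inv x \<in> V"
      using c ab g by simp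
  qed (use AB in auto)
qed

text \<open>
  A group element close to the neutral one moves all points of the compact phase space only
  slightly (tube lemma).  Apply this to the element $h g^{-1}$, which takes $g x$ to $h x$.
\<close>

lemma (in flow) right_uniformly_continuous_orbit_map:
  assumes x: "x \<in> topspace X"
  shows "right_uniformly_continuous_into G T X (\<lambda>g. act g x)"
  unfolding right_uniformly_continuous_into_def
proof (intro conjI allI impI)
  show "(\<lambda>g. act g x) \<in> carrier G \<rightarrow> topspace X" using element_image x by blast
  fix U assume U: "openin (prod_topology X X) U \<and> (\<forall>c\<in>topspace X. (c, c) \<in> U)"
  let ?W = "{p \<in> topspace (prod_topology T X). (snd p, act (fst p) (snd p)) \<in> U}"
  have "continuous_map (prod_topology T X) (prod_topology X X) (\<lambda>p. (snd p, act (fst p) (snd p)))"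
    using continuous_act by (intro continuous_map_pairedI continuous_map_snd) (simp add: case_prod_unfold)
  then have "openin (prod_topology T X) ?W"
    using U by (auto simp: continuous_map_def)
  moreover have "compactin X (topspace X)" using compact by (simp add: compact_space_def)
  moreover have "{\<one>} \<times> topspace X \<subseteq> ?W"
    using U by (auto simp: topspace_eq id_eq_one[symmetric])
  ultimately obtain V N where V: "openin T V" "\<one> \<in> V" and N: "topspace X \<subseteq> N" "V \<times> N \<subseteq> ?W"
    using tube_lemma_right[of T X ?W "topspace X" "\<one>"] by (auto simp: topspace_eq)
  show "\<forall>\<^sub>F (g, h) in right_uniformity G T. (act g x, act h x) \<in> U"
    using eventually_right_uniformity_divide[OF V]
  proof (rule eventually_mono, clarify)
    fix g h assume gh: "g \<in> carrier G" "h \<in> carrier G" "h \<otimes> inv g \<in> V"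
    then have gx: "act g x \<in> topspace X" using element_image x by blast
    have "act (h \<otimes> inv g) (act g x) = act h x"
      using gh x by (simp add: m_assoc flip: composition_rule)
    then show "(act g x, act h x) \<in> U" using N gh gx by fastforce
  qed
qed

section \<open>Extending maps from a group to its greatest ambit\<close>

text \<open>
  Let $G$ act on the functions $p : G \to C$ by $(g p)(h) = p(h g)$.  The closure $E$ of the orbit of
  $f$ in the product topology is compact Hausdorff and invariant, and evaluation at the neutral element
  sends $g f$ to $f(g)$.  So the ambit homomorphism $S(G) \to E$, followed by this evaluation, extends
  $f$.  The action on the whole function space need not be jointly continuous; on $E$ it is, because
  the functions in $E$ inherit the modulus of continuity of $f$: the map $f$ is \<^emph>\<open>right\<close> uniformly
  continuous, and the translations move the argument from the right, hence preserve this modulus.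
\<close>

lemma greatest_ambit_extends:
  fixes C :: "'c topology"
  assumes X: "greatest_ambit G T X act x0"
    and compact: "compact_space C" and Haus: "Hausdorff_space C"
    and f: "right_uniformly_continuous_into G T C f"
  shows "\<exists>F. continuous_map X C F \<and> (\<forall>g\<in>carrier G. F (act g x0) = f g)"
proof -
  interpret X: ambit G T X act x0 using X by (simp add: greatest_ambit_def)
  note X.m_assoc [simp]
  define P where "P = product_topology (\<lambda>_. C) (carrier G)"
  define b where "b g p = (\<lambda>h\<in>carrier G. p (h \<otimes>\<^bsub>G\<^esub> g))" for g and p :: "'a \<Rightarrow> 'c"
  define p0 where "p0 = restrict f (carrier G)"
  define E where "E = P closure_of ((\<lambda>g. b g p0) ` carrier G)"
  define Z where "Z = subtopology P E"
  have topP: "topspace P = carrier G \<rightarrow>\<^sub>E topspace C" by (simp add: P_def)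
  have fC: "f g \<in> topspace C" if "g \<in> carrier G" for g
    using f that by (auto simp: right_uniformly_continuous_into_def)
  have EP: "E \<subseteq> topspace P" unfolding E_def by (rule closure_of_subset_topspace)
  have topZ: "topspace Z = E" unfolding Z_def using EP by auto
  have bp0: "b g p0 \<in> topspace P" if "g \<in> carrier G" for g
    using that fC by (auto simp: b_def p0_def topP)
  have b_one: "b \<one>\<^bsub>G\<^esub> p = p" if "p \<in> topspace P" for p
    using that by (auto simp: b_def topP PiE_def extensional_def)
  have b_mult: "b (g \<otimes>\<^bsub>G\<^esub> h) p = b g (b h p)" if "g \<in> carrier G" "h \<in> carrier G" for g h p
    using that by (auto simp: b_def)
  have b_cont: "continuous_map P P (b g)" if "g \<in> carrier G" for g
    unfolding P_def b_def continuous_map_componentwise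
    using that by (auto simp: intro!: continuous_map_product_projection)
  have b_E: "b g p \<in> E" if g: "g \<in> carrier G" and p: "p \<in> E" for g p
  proof -
    have "b g p \<in> P closure_of (b g ` ((\<lambda>h. b h p0) ` carrier G))"
      using continuous_map_image_closure_subset[OF b_cont[OF g]] p unfolding E_def by blast
    moreover have "b g ` ((\<lambda>h. b h p0) ` carrier G) \<subseteq> (\<lambda>h. b h p0) ` carrier G"
      using g by (auto simp flip: b_mult)
    ultimately show ?thesis unfolding E_def using closure_of_mono by blast
  qed
  have orb_E: "(\<lambda>g. b g p0) ` carrier G \<subseteq> E"
    unfolding E_def using bp0 by (intro closure_of_subset) auto
  have p0_E: "p0 \<in> E"
  proof -
    have "p0 \<in> topspace P" using fC by (simp add: p0_def topP)
    then have "p0 = b \<one>\<^bsub>G\<^esub> p0" by (simp add: b_one)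
    then show ?thesis using orb_E X.one_closed by blast
  qed
  let ?b = "\<lambda>g. restrict (b g) E"
  have bij: "?b g \<in> Bij E" if g: "g \<in> carrier G" for g
  proof -
    have "bij_betw (b g) E E"
    proof (rule bij_betw_byWitness[where f' = "b (inv\<^bsub>G\<^esub> g)"])
      show "\<forall>p\<in>E. b (inv\<^bsub>G\<^esub> g) (b g p) = p" "\<forall>p\<in>E. b g (b (inv\<^bsub>G\<^esub> g) p) = p"
        using g EP b_one by (auto simp flip: b_mult)
    qed (use g b_E in auto)
    then show ?thesis by (simp add: Bij_def)
  qed
  have action: "group_action G (topspace Z) ?b"
    unfolding topZ group_action_def group_hom_def group_hom_axioms_def
  proof (intro conjI homI)
    show "group G" by (rule X.is_group)
    show "group (BijGroup E)" by (rule group_BijGroup)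
    show "?b g \<in> carrier (BijGroup E)" if "g \<in> carrier G" for g
      using bij[OF that] by (simp add: BijGroup_def)
    show "?b (g \<otimes>\<^bsub>G\<^esub> h) = ?b g \<otimes>\<^bsub>BijGroup E\<^esub> ?b h"
      if "g \<in> carrier G" "h \<in> carrier G" for g h
      using that bij b_E by (auto simp: BijGroup_def compose_def b_mult)
  qed
  have compP: "compact_space P" unfolding P_def using compact by (simp add: compact_space_product_topology)
  have HausP: "Hausdorff_space P" unfolding P_def using Haus by (simp add: Hausdorff_space_product_topology)
  have compZ: "compact_space Z"
    unfolding Z_def E_def by (intro compact_space_subtopology closedin_compact_space[OF compP]) simp
  have HausZ: "Hausdorff_space Z" unfolding Z_def by (intro Hausdorff_space_subtopology HausP)
  \<comment> \<open>The common modulus of continuity in the form in which the continuity of the action uses it: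
      if a value \<open>p x\<close> is close to \<open>c\<close>, then so is \<open>p (v \<otimes> x)\<close>, with \<open>V\<close> independent of \<open>p\<close> and \<open>x\<close>.\<close>
  have equi: "\<exists>V W. openin T V \<and> \<one>\<^bsub>G\<^esub> \<in> V \<and> openin C W \<and> c \<in> W \<and>
      (\<forall>p\<in>E. \<forall>v\<in>V. \<forall>x\<in>carrier G. p x \<in> W \<longrightarrow> p (v \<otimes>\<^bsub>G\<^esub> x) \<in> O1)"
    if O1: "openin C O1" and c: "c \<in> O1" for O1 c
  proof -
    have nb: "neighbourhood_base_of (closedin C) C"
      using compact_Hausdorff_imp_regular_space[OF compact Haus] neighbourhood_base_of_closedin by blast
    obtain W1 D1 where 1: "openin C W1" "closedin C D1" "c \<in> W1" "W1 \<subseteq> D1" "D1 \<subseteq> O1"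
      using nb O1 c unfolding neighbourhood_base_of by meson
    obtain W2 D2 where 2: "openin C W2" "closedin C D2" "c \<in> W2" "W2 \<subseteq> D2" "D2 \<subseteq> W1"
      using nb 1 unfolding neighbourhood_base_of by meson
    \<comment> \<open>A neighbourhood of the diagonal in which a pair whose first component is in \<open>W2\<close> has its second
        one in \<open>W1\<close>; the closed set \<open>D1\<close> between \<open>W1\<close> and \<open>O1\<close> lets this pass to the closure \<open>E\<close>.\<close>
    let ?U = "W1 \<times> W1 \<union> (topspace C - D2) \<times> (topspace C - D2)"
    have "openin (prod_topology C C) ?U"
      using 1(1) openin_diff[OF openin_topspace 2(2)]
      by (intro openin_Un) (simp_all add: openin_prod_Times_iff)
    moreover have "\<forall>c\<in>topspace C. (c, c) \<in> ?U" using 2 by auto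
    ultimately have "\<forall>\<^sub>F (x, y) in right_uniformity G T. (f x, f y) \<in> ?U"
      using f unfolding right_uniformly_continuous_into_def by blast
    then obtain V where V: "openin T V" "\<one>\<^bsub>G\<^esub> \<in> V" and
      fV: "\<And>g x y. \<lbrakk>g \<in> carrier G; x \<in> V #>\<^bsub>G\<^esub> g; y \<in> V #>\<^bsub>G\<^esub> g\<rbrakk> \<Longrightarrow> (f x, f y) \<in> ?U"
      unfolding X.eventually_right_uniformity by auto
    have VG: "V \<subseteq> carrier G" using openin_subset[OF V(1)] X.topspace_eq by simp
    have "p (v \<otimes>\<^bsub>G\<^esub> x) \<in> D1" if p: "p \<in> E" and v: "v \<in> V" and x: "x \<in> carrier G" and px: "p x \<in> W2" for p v x
    proof (rule ccontr)
      assume n: "p (v \<otimes>\<^bsub>G\<^esub> x) \<notin> D1"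
      have vx: "v \<in> carrier G" "v \<otimes>\<^bsub>G\<^esub> x \<in> carrier G" using v x VG by auto
      \<comment> \<open>A violation at \<open>p\<close> is an open condition on the two coordinates \<open>x\<close> and \<open>v \<otimes> x\<close>, so some
          translate of \<open>f\<close> violates it as well.\<close>
      define N where "N = {q \<in> topspace P. q x \<in> W2} \<inter>
        {q \<in> topspace P. q (v \<otimes>\<^bsub>G\<^esub> x) \<in> topspace C - D1}"
      have "openin P N"
        using x vx 1 2 unfolding P_def N_def
        by (intro openin_Int openin_continuous_map_preimage[OF continuous_map_product_projection] openin_diff) auto
      moreover have "p \<in> N" using p px n EP vx by (auto simp: N_def topP PiE_iff)
      ultimately obtain a where a: "a \<in> carrier G" "b a p0 \<in> N"
        using p unfolding E_def in_closure_of by blast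
      then have aN: "b a p0 x \<in> W2" "b a p0 (v \<otimes>\<^bsub>G\<^esub> x) \<notin> D1" by (auto simp: N_def)
      have eqs: "b a p0 x = f (x \<otimes>\<^bsub>G\<^esub> a)" "b a p0 (v \<otimes>\<^bsub>G\<^esub> x) = f (v \<otimes>\<^bsub>G\<^esub> (x \<otimes>\<^bsub>G\<^esub> a))"
        using a x vx by (auto simp: b_def p0_def)
      have "x \<otimes>\<^bsub>G\<^esub> a \<in> V #>\<^bsub>G\<^esub> (x \<otimes>\<^bsub>G\<^esub> a)"
        using V(2) a x by (force simp: r_coset_def)
      moreover have "v \<otimes>\<^bsub>G\<^esub> (x \<otimes>\<^bsub>G\<^esub> a) \<in> V #>\<^bsub>G\<^esub> (x \<otimes>\<^bsub>G\<^esub> a)"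
        using v by (auto simp: r_coset_def)
      ultimately have "(b a p0 x, b a p0 (v \<otimes>\<^bsub>G\<^esub> x)) \<in> ?U"
        using fV[of "x \<otimes>\<^bsub>G\<^esub> a"] a x unfolding eqs by blast
      then show False using aN 1(4) 2(4) by blast
    qed
    then have "\<forall>p\<in>E. \<forall>v\<in>V. \<forall>x\<in>carrier G. p x \<in> W2 \<longrightarrow> p (v \<otimes>\<^bsub>G\<^esub> x) \<in> O1"
      using 1(5) by (meson subsetD)
    then show ?thesis using V 2(1,3) by (intro exI[of _ V] exI[of _ W2] conjI)
  qed
  have "continuous_map (prod_topology T Z) P (\<lambda>q. b (fst q) (snd q))"
    unfolding P_def b_def continuous_map_componentwise
  proof (intro conjI ballI)
    fix h assume h: "h \<in> carrier G"
    have ZC: "p x \<in> topspace C" if "p \<in> E" "x \<in> carrier G" for p x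
      using that EP by (auto simp: topP PiE_iff)
    have "\<exists>N. openin (prod_topology T Z) N \<and> q \<in> N \<and> (\<forall>r\<in>N. snd r (h \<otimes>\<^bsub>G\<^esub> fst r) \<in> O1)"
      if q: "q \<in> topspace (prod_topology T Z)" and O1: "openin C O1" "snd q (h \<otimes>\<^bsub>G\<^esub> fst q) \<in> O1" for q O1
    proof -
      define x where "x = h \<otimes>\<^bsub>G\<^esub> fst q"
      have g: "fst q \<in> carrier G" and qE: "snd q \<in> E"
        using q by (auto simp: X.topspace_eq topZ)
      then have x: "x \<in> carrier G" using h by (simp add: x_def)
      obtain V W where V: "openin T V" "\<one>\<^bsub>G\<^esub> \<in> V" and W: "openin C W" "snd q x \<in> W"
        and VW: "\<And>p v x. \<lbrakk>p\<in>E; v\<in>V; x\<in>carrier G; p x \<in> W\<rbrakk> \<Longrightarrow> p (v \<otimes>\<^bsub>G\<^esub> x) \<in> O1"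
        using equi[OF O1] unfolding x_def by blast
      \<comment> \<open>For \<open>g\<close> near \<open>fst q\<close>, the product \<open>h \<otimes> g\<close> is \<open>v \<otimes> x\<close> with \<open>v = h \<otimes> g \<otimes> inv x\<close> near the neutral
          element.\<close>
      let ?A = "{g \<in> topspace T. h \<otimes>\<^bsub>G\<^esub> g \<otimes>\<^bsub>G\<^esub> inv\<^bsub>G\<^esub> x \<in> V}"
      let ?B = "{p \<in> topspace Z. p x \<in> W}"
      have mul: "continuous_map T T (\<lambda>g. u g \<otimes>\<^bsub>G\<^esub> v g)"
        if "continuous_map T T u" "continuous_map T T v" for u v
        using continuous_map_compose[OF continuous_map_pairedI[OF that] X.continuous_mult]
        by (simp add: o_def)
      have "continuous_map T T (\<lambda>g. h \<otimes>\<^bsub>G\<^esub> g \<otimes>\<^bsub>G\<^esub> inv\<^bsub>G\<^esub> x)"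
        using h x X.topspace_eq by (intro mul) (auto simp: continuous_map_const)
      then have "openin T ?A" using V(1) by (rule openin_continuous_map_preimage)
      moreover have "openin Z ?B"
        unfolding Z_def P_def using x W
        by (intro openin_continuous_map_preimage[OF continuous_map_from_subtopology[OF continuous_map_product_projection]])
      moreover have "h \<otimes>\<^bsub>G\<^esub> fst q \<otimes>\<^bsub>G\<^esub> inv\<^bsub>G\<^esub> x = \<one>\<^bsub>G\<^esub>"
        using X.r_inv[OF x] by (simp only: x_def)
      then have "fst q \<in> ?A" using V(2) g X.topspace_eq by simp
      moreover have "snd q \<in> ?B" using W qE topZ by simp
      moreover have "p (h \<otimes>\<^bsub>G\<^esub> g) \<in> O1" if "g \<in> ?A" "p \<in> ?B" for g p
      proof -
        have gG: "g \<in> carrier G" and gV: "h \<otimes>\<^bsub>G\<^esub> g \<otimes>\<^bsub>G\<^esub> inv\<^bsub>G\<^esub> x \<in> V"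
          and p: "p \<in> E" "p x \<in> W"
          using that topZ X.topspace_eq by auto
        have "h \<otimes>\<^bsub>G\<^esub> g \<otimes>\<^bsub>G\<^esub> inv\<^bsub>G\<^esub> x \<otimes>\<^bsub>G\<^esub> x = h \<otimes>\<^bsub>G\<^esub> g"
          using gG h x by simp
        then show ?thesis using VW[OF p(1) gV x p(2)] by (simp only:)
      qed
      ultimately show ?thesis
        by (intro exI[of _ "?A \<times> ?B"]) (auto simp: openin_prod_Times_iff mem_Times_iff)
    qed
    then have "continuous_map (prod_topology T Z) C (\<lambda>q. snd q (h \<otimes>\<^bsub>G\<^esub> fst q))"
      unfolding continuous_map_eq_topcontinuous_at topcontinuous_at_def
      using ZC h by (auto simp: topZ X.topspace_eq)
    then show "continuous_map (prod_topology T Z) C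
        (\<lambda>q. (\<lambda>h\<in>carrier G. snd q (h \<otimes>\<^bsub>G\<^esub> fst q)) h)"
      using h by simp
  qed auto
  then have "continuous_map (prod_topology T Z) Z (\<lambda>q. b (fst q) (snd q))"
    unfolding Z_def continuous_map_in_subtopology
    using b_E by (auto simp: topZ X.topspace_eq simp flip: Z_def)
  then have cont: "continuous_map (prod_topology T Z) Z (\<lambda>(g, p). ?b g p)"
    by (rule continuous_map_eq) (auto simp: topZ)
  have orb: "orbit G ?b p0 = (\<lambda>g. b g p0) ` carrier G"
    unfolding orbit_def using p0_E by auto
  have dense: "Z closure_of (orbit G ?b p0) = topspace Z"
    unfolding orb topZ unfolding Z_def closure_of_subtopology
    using orb_E by (simp add: Int_absorb1 flip: E_def)
  have Zambit: "ambit G T Z ?b p0"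
    using X.topological_group_axioms action compZ HausZ cont p0_E dense topZ
    by (intro ambit.intro flow.intro) (simp_all add: flow_axioms_def ambit_axioms_def)
  obtain F where F: "ambit_hom G X act x0 Z ?b p0 F"
    using greatest_ambit_maps_onto[OF X Zambit] by (elim exE conjE)
  have "continuous_map X C ((\<lambda>p. p \<one>\<^bsub>G\<^esub>) \<circ> F)"
  proof (rule continuous_map_compose)
    show "continuous_map X Z F" using F by (simp add: ambit_hom_def)
    show "continuous_map Z C (\<lambda>p. p \<one>\<^bsub>G\<^esub>)"
      unfolding Z_def P_def
      by (intro continuous_map_from_subtopology continuous_map_product_projection) simp
  qed
  moreover have "((\<lambda>p. p \<one>\<^bsub>G\<^esub>) \<circ> F) (act g x0) = f g" if g: "g \<in> carrier G" for g
  proof -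
    have "F (act g x0) = b g p0"
      using F g X.base_point p0_E by (simp add: ambit_hom_def)
    then show ?thesis using g by (simp add: b_def p0_def)
  qed
  ultimately show ?thesis by blast
qed

section \<open>Changing the group and the phase space\<close>

lemma ambit_of_quotient:
  assumes G: "topological_group G T" and K: "K \<lhd> G"
    and Y: "ambit (G Mod K) (quotient_group_topology G T K) Y act y0"
  shows "ambit G T Y (\<lambda>g. act (K #>\<^bsub>G\<^esub> g)) y0"
proof -
  interpret G: topological_group G T by fact
  interpret K: normal K G by fact
  interpret Y: ambit "G Mod K" "quotient_group_topology G T K" Y act y0 by fact
  have carrier: "carrier (G Mod K) = (\<lambda>g. K #>\<^bsub>G\<^esub> g) ` carrier G"
    by (auto simp: FactGroup_def RCOSETS_def)
  have quot: "continuous_map T (quotient_group_topology G T K) (\<lambda>g. K #>\<^bsub>G\<^esub> g)"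
    unfolding continuous_map_def
    by (auto simp: openin_quotient_group_topology G.topspace_eq Y.topspace_eq carrier)
  have "act \<circ> (\<lambda>g. K #>\<^bsub>G\<^esub> g) \<in> hom G (BijGroup (topspace Y))"
    using K.r_coset_hom_Mod Y.group_hom by (intro hom_compose) (auto simp: group_hom.homh)
  then have action: "group_action G (topspace Y) (\<lambda>g. act (K #>\<^bsub>G\<^esub> g))"
    by (simp add: group_action_def group_hom_def group_hom_axioms_def group_BijGroup
        G.group_axioms o_def)
  have "continuous_map (prod_topology T Y) Y ((\<lambda>(c, y). act c y) \<circ> (\<lambda>p. (K #>\<^bsub>G\<^esub> fst p, snd p)))"
    by (intro continuous_map_compose[OF _ Y.continuous_act] continuous_map_pairedI continuous_map_snd
        continuous_map_compose[OF continuous_map_fst quot, unfolded o_def])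
  then have cont: "continuous_map (prod_topology T Y) Y (\<lambda>(g, y). act (K #>\<^bsub>G\<^esub> g) y)"
    by (simp add: o_def case_prod_unfold)
  have "orbit G (\<lambda>g. act (K #>\<^bsub>G\<^esub> g)) y0 = orbit (G Mod K) act y0"
    unfolding orbit_def carrier by auto
  then show ?thesis
    using G action Y.compact Y.Hausdorff_phase_space cont Y.base_point Y.dense_orbit
    by (intro ambit.intro flow.intro) (simp_all add: flow_axioms_def ambit_axioms_def)
qed

text \<open>
  The action is not prescribed on \<open>P\<close>, so a homeomorphism that respects the base points
  is enough: the action on \<open>P\<close> is the transported one.
\<close>

lemma homeomorphic_map_imp_ambit_iso:
  assumes X: "ambit G T X act x0" and h: "homeomorphic_map P X h"
    and z: "z \<in> topspace P" "h z = x0"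
  shows "\<exists>act'. ambit G T P act' z \<and> (\<exists>f. ambit_iso G X act x0 P act' z f)"
proof -
  interpret X: ambit G T X act x0 by fact
  obtain f where hf: "homeomorphic_maps P X h f" using h unfolding homeomorphic_map_maps by (elim exE)
  then have fh: "homeomorphic_maps X P f h" by (rule homeomorphic_maps_sym[THEN iffD1])
  let ?a = "\<lambda>g. restrict (\<lambda>w. f (act g (inv_into (topspace X) f w))) (topspace P)"
  have fz: "f x0 = z" using hf z unfolding homeomorphic_maps_def by metis
  have fcont: "continuous_map X P f" using fh by (simp add: homeomorphic_maps_def)
  have fbij: "bij_betw f (topspace X) (topspace P)"
    using homeomorphic_maps_imp_map[OF fh]
    by (simp only: bij_betw_def homeomorphic_imp_surjective_map homeomorphic_imp_injective_map)
  have inv: "inv_into (topspace X) f (f x) = x" if "x \<in> topspace X" for x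
    using fbij that by (rule bij_betw_inv_into_left)
  have fP: "f x \<in> topspace P" if "x \<in> topspace X" for x
    using fbij that by (rule bij_betw_apply)
  have "ambit G T P ?a (f x0)" by (rule ambit_transport[OF X fh])
  then have "ambit G T P ?a z" by (simp only: fz)
  moreover have "ambit_iso G X act x0 P ?a z f"
    unfolding ambit_iso_def ambit_hom_def
  proof (intro conjI ballI)
    show "f (act g x) = ?a g (f x)" if "g \<in> carrier G" "x \<in> topspace X" for g x
      using inv fP that(2) by simp
  qed (fact fcont fz fbij)+
  ultimately show ?thesis by (intro exI conjI)
qed

section \<open>Splitting off the compact normal subgroup\<close>

theorem theorem5:
  fixes G :: "('a, 'm) monoid_scheme" and T :: "'a topology" and K :: "'a set"
    and X :: "'x topology" and act :: "'a \<Rightarrow> 'x \<Rightarrow> 'x" and x0 :: 'x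
    and Y :: "'y topology" and act' :: "'a set \<Rightarrow> 'y \<Rightarrow> 'y" and y0 :: 'y
    and s :: "'a set \<Rightarrow> 'a"
  assumes "SIN_group G T"
    and "K \<lhd> G" and "compactin T K"
    and "greatest_ambit G T X act x0"
    and "greatest_ambit (G Mod K) (quotient_group_topology G T K) Y act' y0"
    and "acts_freely G K X act"
    and "cross_section G K s"
    and "right_uniformly_continuous (G Mod K) (quotient_group_topology G T K) G T s"
  shows "\<exists>act''. ambit G T (prod_topology Y (subtopology T K)) act'' (y0, \<one>\<^bsub>G\<^esub>) \<and>
           (\<exists>f. ambit_iso G X act x0 (prod_topology Y (subtopology T K)) act'' (y0, \<one>\<^bsub>G\<^esub>) f)"
proof -
  interpret X: ambit G T X act x0 using assms(4) by (simp add: greatest_ambit_def)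
  interpret K: normal K G by (rule assms(2))
  let ?H = "G Mod K" and ?U = "quotient_group_topology G T K"
  interpret Y: ambit ?H ?U Y act' y0 using assms(5) by (simp add: greatest_ambit_def)
  let ?P = "prod_topology Y (subtopology T K)"
  have KG: "K \<subseteq> carrier G" by (rule K.subset)
  have topK: "topspace (subtopology T K) = K" using KG X.topspace_eq by auto
  have coset: "K #>\<^bsub>G\<^esub> g \<in> carrier ?H" if "g \<in> carrier G" for g
    using that by (auto simp: FactGroup_def RCOSETS_def)
  have sG: "s c \<in> carrier G" and sc: "K #>\<^bsub>G\<^esub> s c = c" if "c \<in> carrier ?H" for c
    using assms(7) that by (auto simp: cross_section_def)

  have "right_uniformly_continuous_into ?H ?U X (\<lambda>c. act (s c) x0)"
    unfolding right_uniformly_continuous_into_def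
  proof (intro conjI allI impI)
    show "(\<lambda>c. act (s c) x0) \<in> carrier ?H \<rightarrow> topspace X"
      using sG X.element_image X.base_point by blast
    fix U assume "openin (prod_topology X X) U \<and> (\<forall>c\<in>topspace X. (c, c) \<in> U)"
    then have "\<forall>\<^sub>F (g, h) in right_uniformity G T. (act g x0, act h x0) \<in> U"
      using X.right_uniformly_continuous_orbit_map[OF X.base_point]
      unfolding right_uniformly_continuous_into_def by blast
    moreover have "LIM (c, d) right_uniformity ?H ?U. (s c, s d) :> right_uniformity G T"
      using assms(8) by (simp add: right_uniformly_continuous_def)
    ultimately show "\<forall>\<^sub>F (c, d) in right_uniformity ?H ?U. (act (s c) x0, act (s d) x0) \<in> U"
      unfolding filterlim_iff by (fastforce simp: case_prod_unfold)
  qed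
  then obtain \<sigma> where \<sigma>: "continuous_map Y X \<sigma>"
    and \<sigma>s: "\<And>c. c \<in> carrier ?H \<Longrightarrow> \<sigma> (act' c y0) = act (s c) x0"
    using greatest_ambit_extends[OF assms(5) X.compact X.Hausdorff_phase_space] by blast
  have \<sigma>X: "\<sigma> y \<in> topspace X" if "y \<in> topspace Y" for y
    using \<sigma> that by (auto simp: continuous_map_def)

  obtain \<pi> where \<pi>: "ambit_hom G X act x0 Y (\<lambda>g. act' (K #>\<^bsub>G\<^esub> g)) y0 \<pi>"
    using greatest_ambit_maps_onto[OF assms(4) ambit_of_quotient[OF X.topological_group_axioms assms(2) Y.ambit_axioms]]
    by blast
  then have \<pi>cont: "continuous_map X Y \<pi>" and \<pi>x0: "\<pi> x0 = y0"
    and \<pi>act: "\<And>g x. \<lbrakk>g \<in> carrier G; x \<in> topspace X\<rbrakk> \<Longrightarrow> \<pi> (act g x) = act' (K #>\<^bsub>G\<^esub> g) (\<pi> x)"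
    by (auto simp: ambit_hom_def)
  have \<pi>Y: "\<pi> x \<in> topspace Y" if "x \<in> topspace X" for x
    using \<pi>cont that by (auto simp: continuous_map_def)
  have \<pi>\<sigma>: "\<pi> (\<sigma> y) = y" if y: "y \<in> topspace Y" for y
  proof (rule forall_in_closure_of_eq[OF _ Y.Hausdorff_phase_space])
    show "y \<in> Y closure_of (orbit ?H act' y0)" using y Y.dense_orbit by simp
    show "continuous_map Y Y (\<lambda>y. \<pi> (\<sigma> y))" using continuous_map_compose[OF \<sigma> \<pi>cont] by (simp add: o_def)
    show "continuous_map Y Y (\<lambda>y. y)" by simp
    show "\<pi> (\<sigma> z) = z" if "z \<in> orbit ?H act' y0" for z
      using that X.base_point unfolding orbit_def by (auto simp: \<sigma>s \<pi>act \<pi>x0 sG sc)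
  qed
  have \<pi>K: "\<pi> (act k x) = \<pi> x" if k: "k \<in> K" and x: "x \<in> topspace X" for k x
  proof -
    have "K #>\<^bsub>G\<^esub> k = \<one>\<^bsub>?H\<^esub>"
      using k by (simp add: K.rcos_const X.coset_join2 K.subgroup_axioms KG subsetD)
    then show ?thesis using \<pi>act[of k x] k x KG \<pi>Y[OF x] Y.id_eq_one[symmetric] by auto
  qed

  \<comment> \<open>The cross section need not send the coset \<open>K\<close> to the neutral element; \<open>a\<close> repairs this.\<close>
  define a where "a = inv\<^bsub>G\<^esub> s K"
  have KH: "K \<in> carrier ?H" using coset[of "\<one>\<^bsub>G\<^esub>"] by (simp add: X.coset_mult_one KG)
  have sK: "s K \<in> K" using sc[OF KH] sG[OF KH] X.rcos_self[OF _ K.subgroup_axioms] by blast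
  then have aK: "a \<in> K" by (simp add: a_def)
  define \<psi> where "\<psi> = (\<lambda>(y, k). act (k \<otimes>\<^bsub>G\<^esub> a) (\<sigma> y))"
  have \<psi>cont: "continuous_map ?P X \<psi>"
  proof -
    have k: "continuous_map ?P T snd"
      using continuous_map_compose[OF continuous_map_snd continuous_map_id_subt] by (simp add: o_def)
    have "continuous_map ?P T ((\<lambda>(x, y). x \<otimes>\<^bsub>G\<^esub> y) \<circ> (\<lambda>p. (snd p, a)))"
      using aK KG X.topspace_eq k
      by (intro continuous_map_compose[OF _ X.continuous_mult] continuous_map_pairedI) auto
    then have "continuous_map ?P (prod_topology T X) (\<lambda>p. (snd p \<otimes>\<^bsub>G\<^esub> a, \<sigma> (fst p)))"
      using continuous_map_compose[OF continuous_map_fst \<sigma>]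
      by (intro continuous_map_pairedI) (auto simp: o_def)
    from continuous_map_compose[OF this X.continuous_act] show ?thesis
      by (simp add: \<psi>_def o_def case_prod_unfold)
  qed
  have compP: "compact_space ?P"
    using Y.compact assms(3) by (simp add: compact_space_prod_topology compact_space_subtopology)
  have \<psi>X: "\<psi> ` topspace ?P \<subseteq> topspace X" using \<psi>cont by (auto simp: continuous_map_def)
  have "orbit G act x0 \<subseteq> \<psi> ` topspace ?P"
  proof
    fix x assume "x \<in> orbit G act x0"
    then obtain g where g: "g \<in> carrier G" "x = act g x0" by (auto simp: orbit_def)
    let ?c = "K #>\<^bsub>G\<^esub> g"
    have c: "?c \<in> carrier ?H" using coset g by blast
    have "g \<in> K #>\<^bsub>G\<^esub> s ?c" using sc[OF c] X.rcos_self[OF g(1) K.subgroup_axioms] by simp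
    then obtain k where k: "k \<in> K" "g = k \<otimes>\<^bsub>G\<^esub> s ?c" by (auto simp: r_coset_def)
    have "k \<otimes>\<^bsub>G\<^esub> s K \<otimes>\<^bsub>G\<^esub> a = k"
      using k(1) sK KG by (simp add: a_def X.m_assoc subsetD)
    then have "\<psi> (act' ?c y0, k \<otimes>\<^bsub>G\<^esub> s K) = act k (act (s ?c) x0)"
      using \<sigma>s[OF c] by (simp add: \<psi>_def)
    also have "\<dots> = act (k \<otimes>\<^bsub>G\<^esub> s ?c) x0"
      using X.composition_rule[OF X.base_point _ sG[OF c], of k] k(1) KG by auto
    also have "\<dots> = x" using k(2) g(2) by simp
    finally have "x = \<psi> (act' ?c y0, k \<otimes>\<^bsub>G\<^esub> s K)" ..
    moreover have "(act' ?c y0, k \<otimes>\<^bsub>G\<^esub> s K) \<in> topspace ?P"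
      using c k sK Y.element_image Y.base_point topK by auto
    ultimately show "x \<in> \<psi> ` topspace ?P" by blast
  qed
  moreover have "closedin X (\<psi> ` topspace ?P)"
    using compP \<psi>cont X.Hausdorff_phase_space
    by (metis compactin_imp_closedin image_compactin compact_space_def)
  ultimately have "X closure_of (orbit G act x0) \<subseteq> \<psi> ` topspace ?P"
    by (rule closure_of_minimal)
  then have \<psi>surj: "\<psi> ` topspace ?P = topspace X"
    using \<psi>X unfolding X.dense_orbit by (rule antisym[rotated])
  have \<psi>inj: "inj_on \<psi> (topspace ?P)"
  proof (rule inj_onI, clarify)
    fix y k y' k'
    assume yk: "(y, k) \<in> topspace ?P" "(y', k') \<in> topspace ?P" and eq: "\<psi> (y, k) = \<psi> (y', k')"
    then have y: "y \<in> topspace Y" "y' \<in> topspace Y" and k: "k \<in> K" "k' \<in> K" using topK by auto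
    have ka: "k \<otimes>\<^bsub>G\<^esub> a \<in> K" "k' \<otimes>\<^bsub>G\<^esub> a \<in> K" using k aK by auto
    have "\<pi> (\<psi> (y, k)) = y" "\<pi> (\<psi> (y', k')) = y'"
      using y ka by (simp_all add: \<psi>_def \<pi>K \<sigma>X \<pi>\<sigma>)
    then have yy: "y = y'" using eq by simp
    let ?g = "k \<otimes>\<^bsub>G\<^esub> a" and ?g' = "k' \<otimes>\<^bsub>G\<^esub> a"
    have gG: "?g \<in> carrier G" "?g' \<in> carrier G" using ka KG by auto
    \<comment> \<open>The element \<open>inv ?g' \<otimes> ?g\<close> of \<open>K\<close> fixes \<open>\<sigma> y\<close>, so it is neutral by freeness.\<close>
    have "act (inv\<^bsub>G\<^esub> ?g' \<otimes>\<^bsub>G\<^esub> ?g) (\<sigma> y) = act (inv\<^bsub>G\<^esub> ?g') (act ?g' (\<sigma> y))"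
      using X.composition_rule[OF \<sigma>X[OF y(1)] _ gG(1), of "inv\<^bsub>G\<^esub> ?g'"] gG eq yy by (simp add: \<psi>_def)
    also have "\<dots> = \<sigma> y"
      using X.orbit_sym_aux[OF gG(2) \<sigma>X[OF y(1)] refl] .
    finally have "inv\<^bsub>G\<^esub> ?g' \<otimes>\<^bsub>G\<^esub> ?g = \<one>\<^bsub>G\<^esub>"
      using assms(6) ka \<sigma>X[OF y(1)] unfolding acts_freely_def by blast
    then have "?g = ?g'" using gG by (metis X.inv_closed X.inv_equality X.inv_inv)
    then have "k = k'" using k aK KG X.right_cancel by blast
    then show "y = y' \<and> k = k'" using yy by simp
  qed
  have "homeomorphic_map ?P X \<psi>"
    using \<psi>cont compP X.Hausdorff_phase_space \<psi>surj \<psi>inj by (rule continuous_imp_homeomorphic_map)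
  moreover have "(y0, \<one>\<^bsub>G\<^esub>) \<in> topspace ?P" using Y.base_point topK by simp
  moreover have "\<psi> (y0, \<one>\<^bsub>G\<^esub>) = x0"
  proof -
    have "act' \<one>\<^bsub>?H\<^esub> y0 = y0" using Y.id_eq_one[symmetric] Y.base_point by simp
    then have "\<sigma> y0 = act (s K) x0" using \<sigma>s[OF KH] by simp
    then show ?thesis
      using aK KG X.orbit_sym_aux[OF sG[OF KH] X.base_point refl] by (simp add: \<psi>_def a_def subsetD)
  qed
  ultimately show ?thesis by (rule homeomorphic_map_imp_ambit_iso[OF X.ambit_axioms])
qed

end
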